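(* Let $\alpha \in (0,2)$ and let $p(\cdot)$ be a symmetric transition rate with $p(\cdot) \in \mathrm{DAN}(\alpha)$ and $p(1)>0$. For $n \in \mathbb{N}$ let $\lambda_n$ be the spectral gap of the continuous-time Markov chain $\{y_n(t); t \ge 0\}$ with state space $\Lambda_n = \{-n,\dots,n\}$ and jump rates $r(x,y) = p(y-x)$, $x,y \in \Lambda_n$. Then there exist constants $\kappa_1, \kappa_2 \in (0,\infty)$ such that \[ \kappa_1 (2n+1)^{-\alpha} \le \lambda_n \le \kappa_2 (2n+1)^{-\alpha} \] for any $n \in \mathbb{N}$.
   Context: $\mathbb{N} = \{1,2,\dots\}$. A transition rate is a non-zero function $p:\mathbb{Z}\to[0,\infty)$ with $p(0)=0$ and $\sum_{z\in\mathbb{Z}}p(z)<\infty$; it is symmetric if $p(z)=p(-z)$ for all $z$. A symmetric transition rate $p$ is in $\mathrm{DAN}(\alpha)$ (domain of normal attraction of an $\alpha$-stable law), $\alpha\in(0,2)$, if there is a constant $c\in(0,\infty)$ with $\lim_{x\to\infty} x^\alpha\sum_{y\ge x}p(y)=c$. The generator of a continuous-time Markov chain on a finite set $\Omega$ with jump rates $r(x,y)\ge 0$, $r(x,x)=0$, is $Lf(x)=\sum_{y\in\Omega}r(x,y)(f(y)-f(x))$ for $f:\Omega\to\mathbb{R}$. If the chain is irreducible and reversible with respect to its unique equilibrium probability measure $\mu$ (i.e. $\mu(x)r(x,y)=\mu(y)r(y,x)$), its spectral gap is the smallest non-zero eigenvalue of $-L$, equivalently \[ \lambda=\inf\Big\{\mathcal{D}(f):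 \int f^2\,d\mu=1,\ \int f\,d\mu=0\Big\},\qquad \mathcal{D}(f)=\int f(-Lf)\,d\mu=\tfrac12\sum_{x,y\in\Omega}\mu(x)r(x,y)(f(x)-f(y))^2 . \] For the chain on $\Lambda_n$ with rates $p(y-x)$, $p$ symmetric and $p(1)>0$, the chain is irreducible and reversible with respect to the uniform measure on $\Lambda_n$. *)

theory Defs
  imports "HOL-Analysis.Analysis"
begin

definition transition_rate :: "(int \<Rightarrow> real) \<Rightarrow> bool" where
  "transition_rate p \<longleftrightarrow>
     (\<forall>z. 0 \<le> p z) \<and> (\<exists>z. p z \<noteq> 0) \<and> p 0 = 0 \<and> p summable_on UNIV"

definition symmetric_rate :: "(int \<Rightarrow> real) \<Rightarrow> bool" where
  "symmetric_rate p \<longleftrightarrow> (\<forall>z. p z = p (- z))"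

text \<open>
  Domain of normal attraction of an \<open>\<alpha>\<close>-stable law, for symmetric transition rates and
  \<open>0 < \<alpha> < 2\<close>; these standing conditions are not part of the predicate. The limit is along real
  \<open>x\<close>.
\<close>

definition DAN :: "real \<Rightarrow> (int \<Rightarrow> real) \<Rightarrow> bool" where
  "DAN \<alpha> p \<longleftrightarrow>
     (\<exists>c>0. ((\<lambda>x::real. x powr \<alpha> * (\<Sum>\<^sub>\<infinity>y\<in>{y::int. x \<le> of_int y}. p y)) \<longlongrightarrow> c) at_top)"

definition generator :: "'a set \<Rightarrow> ('a \<Rightarrow> 'a \<Rightarrow> real) \<Rightarrow> ('a \<Rightarrow> real) \<Rightarrow> 'a \<Rightarrow> real" where
  "generator \<Omega> r f x = (\<Sum>y\<in>\<Omega>. r x y * (f y - f x))"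

text \<open>
  Functions on \<open>\<Omega>\<close> are represented by total functions of which only the values on \<open>\<Omega>\<close> matter, so
  an eigenfunction has to be non-zero somewhere on \<open>\<Omega>\<close>.
\<close>

definition neg_generator_eigenvalue :: "'a set \<Rightarrow> ('a \<Rightarrow> 'a \<Rightarrow> real) \<Rightarrow> real \<Rightarrow> bool" where
  "neg_generator_eigenvalue \<Omega> r l \<longleftrightarrow>
     (\<exists>f. (\<exists>x\<in>\<Omega>. f x \<noteq> 0) \<and> (\<forall>x\<in>\<Omega>. - generator \<Omega> r f x = l * f x))"

text \<open>
  Meaningful for irreducible reversible chains on a finite \<open>\<Omega>\<close> with at least two states: then
  \<open>- L\<close> is self-adjoint in \<open>L\<^sup>2(\<mu>)\<close>, all its eigenvalues are real, finite in number and not all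
  zero, so the minimum exists. Otherwise the value of \<open>LEAST\<close> may be unspecified.
\<close>

definition spectral_gap :: "'a set \<Rightarrow> ('a \<Rightarrow> 'a \<Rightarrow> real) \<Rightarrow> real" where
  "spectral_gap \<Omega> r = (LEAST l. neg_generator_eigenvalue \<Omega> r l \<and> l \<noteq> 0)"

end

theory Submission
  imports Defs
begin

text \<open>
  Write \<open>S d\<close> for the sum of \<open>(f (x + d) - f x)\<^sup>2\<close> over all \<open>x\<close> with \<open>x\<close> and \<open>x + d\<close> in
  \<open>{-n..n}\<close>, so that the Dirichlet form is \<open>D = (\<Sum>d=1..2n. p d * S d)\<close> up to normalization. For the lower
  bound one shows \<open>S d \<le> C d\<^sup>\<alpha> D\<close> by strong induction on \<open>d\<close>. We have
  \<open>S d \<le> 2 S (d - z) + 2 S z\<close> for \<open>0 \<le> z \<le> d\<close>; averaging this over \<open>z \<in> [(1 - \<epsilon>) d, d)\<close> with weights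
  \<open>p z\<close>, whose total is of order \<open>d\<^sup>-\<^sup>\<alpha>\<close> by the tail asymptotics, the second term contributes
  \<open>O(d\<^sup>\<alpha> D)\<close> and the first one at most \<open>2 C \<epsilon>\<^sup>\<alpha> d\<^sup>\<alpha> D\<close>, where \<open>2 \<epsilon>\<^sup>\<alpha> \<le> 1/2\<close>. Small \<open>d\<close> are
  handled by nearest-neighbour jumps, using \<open>p 1 > 0\<close>. Summing over \<open>d\<close> gives the Poincare inequality
  with constant \<open>C (2n+1)\<^sup>\<alpha>\<close>. The upper bound comes from the test function \<open>f x = x\<close>, since the
  truncated second moment of \<open>p\<close> up to \<open>M\<close> is \<open>O(M\<^bsup>2-\<alpha>\<^esup>)\<close>.
\<close>

subsection \<open>Variational characterization of the spectral gap\<close>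

text \<open>Dirichlet form for counting measure in place of the uniform probability measure; the
  common factor cancels against the sums of squares it is compared with.\<close>

definition energy :: "'a set \<Rightarrow> ('a \<Rightarrow> 'a \<Rightarrow> real) \<Rightarrow> ('a \<Rightarrow> real) \<Rightarrow> real" where
  "energy \<Omega> r f = (\<Sum>x\<in>\<Omega>. \<Sum>y\<in>\<Omega>. r x y * (f x - f y)\<^sup>2) / 2"

text \<open>Swapping \<open>x\<close> and \<open>y\<close> and using the symmetry of
  \<open>r\<close> gives a second expression for the left-hand side; averaging the two turns
  \<open>g x\<close> into the increment \<open>g x - g y\<close>.\<close>

lemma sum_mult_generator:
  assumes sym: "\<And>x y. r x y = r y x"
  shows "(\<Sum>x\<in>\<Omega>. g x * (- generator \<Omega> r f x)) =
    (\<Sum>x\<in>\<Omega>. \<Sum>y\<in>\<Omega>. r x y * (f x - f y) * (g x - g y)) / 2"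
proof -
  have 1: "(\<Sum>x\<in>\<Omega>. g x * (- generator \<Omega> r f x)) = (\<Sum>x\<in>\<Omega>. \<Sum>y\<in>\<Omega>. r x y * (f x - f y) * g x)"
    by (simp add: generator_def sum_distrib_left sum_negf[symmetric] algebra_simps)
  also have 2: "\<dots> = (\<Sum>x\<in>\<Omega>. \<Sum>y\<in>\<Omega>. r x y * (f y - f x) * g y)"
    by (subst sum.swap) (simp add: sym)
  finally have "2 * (\<Sum>x\<in>\<Omega>. g x * (- generator \<Omega> r f x)) =
    (\<Sum>x\<in>\<Omega>. \<Sum>y\<in>\<Omega>. r x y * (f x - f y) * g x) + (\<Sum>x\<in>\<Omega>. \<Sum>y\<in>\<Omega>. r x y * (f y - f x) * g y)"
    using 1 by linarith
  also have "\<dots> = (\<Sum>x\<in>\<Omega>. \<Sum>y\<in>\<Omega>. r x y * (f x - f y) * (g x - g y))"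
    by (simp add: sum.distrib[symmetric] algebra_simps)
  finally show ?thesis by simp
qed

lemma sum_mult_generator_self:
  assumes "\<And>x y. r x y = r y x"
  shows "(\<Sum>x\<in>\<Omega>. f x * (- generator \<Omega> r f x)) = energy \<Omega> r f"
  unfolding energy_def by (subst sum_mult_generator[OF assms]) (simp_all add: power2_eq_square mult.assoc)

lemma sum_generator_eq_0:
  assumes "\<And>x y. r x y = r y x"
  shows "(\<Sum>x\<in>\<Omega>. generator \<Omega> r f x) = 0"
  using sum_mult_generator[where g="\<lambda>_. 1" and r=r and f=f and \<Omega>=\<Omega>] assms by (simp add: sum_negf)

lemma energy_add_scaled:
  assumes "\<And>x y. r x y = r y x"
  shows "energy \<Omega> r (\<lambda>x. f x + t * g x) =
    energy \<Omega> r f + 2 * t * (\<Sum>x\<in>\<Omega>. g x * (- generator \<Omega> r f x)) + t\<^sup>2 * energy \<Omega> r g"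
  unfolding energy_def sum_mult_generator[OF assms]
  by (simp add: sum_distrib_left sum.distrib[symmetric] add_divide_distrib[symmetric])
     (auto intro!: sum.cong simp: power2_eq_square algebra_simps)

lemma energy_scaled: "energy \<Omega> r (\<lambda>x. t * f x) = t\<^sup>2 * energy \<Omega> r f"
  unfolding energy_def
  by (simp add: sum_distrib_left right_diff_distrib[symmetric] power_mult_distrib mult_ac)

text \<open>The energy is continuous and attains its infimum on the compact set of mean-zero
  functions of unit norm; homogeneity extends the bound to all mean-zero \<open>h\<close>. The
  function \<open>g\<close> witnesses that this set is non-empty.\<close>

lemma exists_energy_minimizer:
  fixes g :: "'a \<Rightarrow> real"
  assumes fin: "finite \<Omega>" and g0: "(\<Sum>x\<in>\<Omega>. g x) = 0" and gnz: "(\<Sum>x\<in>\<Omega>. (g x)\<^sup>2) > 0"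
  shows "\<exists>f. (\<Sum>x\<in>\<Omega>. f x) = 0 \<and> (\<Sum>x\<in>\<Omega>. (f x)\<^sup>2) = 1 \<and>
    (\<forall>h. (\<Sum>x\<in>\<Omega>. h x) = 0 \<longrightarrow> energy \<Omega> r f * (\<Sum>x\<in>\<Omega>. (h x)\<^sup>2) \<le> energy \<Omega> r h)"
proof -
  \<comment> \<open>Total functions are pinned to 0 off \<open>\<Omega>\<close>, so that the box is
    a product of compact sets and hence compact in the product topology.\<close>
  define B where "B = (\<Pi>\<^sub>E x\<in>UNIV. if x \<in> \<Omega> then {-1..1} else {0::real})"
  define C where "C = {f :: 'a \<Rightarrow> real. (\<Sum>x\<in>\<Omega>. f x) = 0} \<inter> {f. (\<Sum>x\<in>\<Omega>. (f x)\<^sup>2) = 1}"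
  have cont[continuous_intros]: "continuous_on UNIV (\<lambda>f :: 'a \<Rightarrow> real. f x)" for x
    by (rule continuous_on_product_coordinates)
  have "compactin (product_topology (\<lambda>x. euclidean) UNIV) B"
    unfolding B_def by (subst compactin_PiE) auto
  hence "compact B" by (simp add: euclidean_product_topology)
  moreover have "closed C"
    unfolding C_def by (intro closed_Int closed_Collect_eq continuous_intros)
  ultimately have comp: "compact (B \<inter> C)" by (rule compact_Int_closed)
  define nrm where "nrm h = (\<lambda>x. if x \<in> \<Omega> then (1 / sqrt (\<Sum>x\<in>\<Omega>. (h x)\<^sup>2)) * h x else 0)"
    for h :: "'a \<Rightarrow> real"
  have nrm_in: "nrm h \<in> B \<inter> C" if "(\<Sum>x\<in>\<Omega>. h x) = 0" "(\<Sum>x\<in>\<Omega>. (h x)\<^sup>2) > 0" for h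
  proof -
    have s0: "(\<Sum>x\<in>\<Omega>. nrm h x) = (1 / sqrt (\<Sum>x\<in>\<Omega>. (h x)\<^sup>2)) * (\<Sum>x\<in>\<Omega>. h x)"
      unfolding nrm_def sum_distrib_left by (rule sum.cong) auto
    have "(\<Sum>x\<in>\<Omega>. (nrm h x)\<^sup>2) = (1 / sqrt (\<Sum>x\<in>\<Omega>. (h x)\<^sup>2))\<^sup>2 * (\<Sum>x\<in>\<Omega>. (h x)\<^sup>2)"
      unfolding nrm_def sum_distrib_left by (rule sum.cong) (auto simp: power_divide)
    also have "\<dots> = 1" using that(2) by (simp add: power_divide)
    finally have s1: "(\<Sum>x\<in>\<Omega>. (nrm h x)\<^sup>2) = 1" .
    have "nrm h x \<in> {-1..1}" if "x \<in> \<Omega>" for x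
    proof -
      have "(nrm h x)\<^sup>2 \<le> (\<Sum>x\<in>\<Omega>. (nrm h x)\<^sup>2)"
        using fin that by (intro member_le_sum) auto
      thus ?thesis using s1 abs_square_le_1[of "nrm h x"] by (auto simp: abs_le_iff)
    qed
    hence "nrm h \<in> B" by (auto simp: B_def nrm_def)
    thus ?thesis using s0 s1 that(1) by (auto simp: C_def)
  qed
  have energy_nrm: "energy \<Omega> r (nrm h) * (\<Sum>x\<in>\<Omega>. (h x)\<^sup>2) = energy \<Omega> r h"
    if "(\<Sum>x\<in>\<Omega>. (h x)\<^sup>2) > 0" for h
  proof -
    have "energy \<Omega> r (nrm h) = energy \<Omega> r (\<lambda>x. (1 / sqrt (\<Sum>x\<in>\<Omega>. (h x)\<^sup>2)) * h x)"
      unfolding energy_def nrm_def by simp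
    also have "\<dots> = energy \<Omega> r h / (\<Sum>x\<in>\<Omega>. (h x)\<^sup>2)"
      unfolding energy_scaled using that by (simp add: power_divide)
    finally show ?thesis using that by simp
  qed
  have "continuous_on (B \<inter> C) (energy \<Omega> r)"
    unfolding energy_def by (rule continuous_on_subset[of UNIV]) (auto intro!: continuous_intros)
  from continuous_attains_inf[OF comp _ this] nrm_in[OF g0 gnz]
  obtain f where f: "f \<in> B \<inter> C" "\<And>h. h \<in> B \<inter> C \<Longrightarrow> energy \<Omega> r f \<le> energy \<Omega> r h" by blast
  show ?thesis
  proof (intro exI[of _ f] conjI allI impI)
    fix h :: "'a \<Rightarrow> real" assume h0: "(\<Sum>x\<in>\<Omega>. h x) = 0"
    show "energy \<Omega> r f * (\<Sum>x\<in>\<Omega>. (h x)\<^sup>2) \<le> energy \<Omega> r h"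
    proof (cases "(\<Sum>x\<in>\<Omega>. (h x)\<^sup>2) > 0")
      case True
      have "energy \<Omega> r f * (\<Sum>x\<in>\<Omega>. (h x)\<^sup>2) \<le> energy \<Omega> r (nrm h) * (\<Sum>x\<in>\<Omega>. (h x)\<^sup>2)"
        using f(2)[OF nrm_in[OF h0 True]] True by (intro mult_right_mono) auto
      thus ?thesis using energy_nrm[OF True] by simp
    next
      case False
      hence s: "(\<Sum>x\<in>\<Omega>. (h x)\<^sup>2) = 0"
        using sum_nonneg[of \<Omega> "\<lambda>x. (h x)\<^sup>2"] by force
      hence "\<forall>x\<in>\<Omega>. h x = 0" using fin by (simp add: sum_nonneg_eq_0_iff)
      thus ?thesis unfolding s by (simp add: energy_def)
    qed
  qed (use f(1) in \<open>auto simp: C_def\<close>)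
qed

lemma linear_coeff_eq_0_of_quadratic_nonneg:
  fixes a b :: real
  assumes "\<And>t. 0 \<le> 2 * t * a + t\<^sup>2 * b"
  shows "a = 0"
proof (rule ccontr)
  assume "a \<noteq> 0"
  \<comment> \<open>With \<open>t = - s * a\<close> the linear term wins over the quadratic one as
    soon as \<open>s * b < 2\<close>.\<close>
  define s where "s = 1 / (\<bar>b\<bar> + 1)"
  have s: "s > 0" "s * b < 2" by (auto simp: s_def field_simps)
  have "0 \<le> 2 * (- s * a) * a + (- s * a)\<^sup>2 * b" by (rule assms)
  also have "\<dots> = (s * a\<^sup>2) * (s * b - 2)" by (simp add: power2_eq_square algebra_simps)
  also have "\<dots> < 0" using s \<open>a \<noteq> 0\<close> by (intro mult_pos_neg) auto
  finally show False by simp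
qed

text \<open>A minimizer of the energy is an eigenfunction, so the least non-zero eigenvalue exists and
  has the usual variational description.\<close>

lemma spectral_gap_variational:
  assumes fin: "finite \<Omega>" and sym: "\<And>x y. r x y = r y x"
    and k: "k > 0"
    and poincare: "\<And>h. (\<Sum>x\<in>\<Omega>. h x) = 0 \<Longrightarrow> k * (\<Sum>x\<in>\<Omega>. (h x)\<^sup>2) \<le> energy \<Omega> r h"
    and g0: "(\<Sum>x\<in>\<Omega>. g x) = 0" and gnz: "(\<Sum>x\<in>\<Omega>. (g x)\<^sup>2) > 0"
  shows "k \<le> spectral_gap \<Omega> r"
    and "spectral_gap \<Omega> r * (\<Sum>x\<in>\<Omega>. (g x)\<^sup>2) \<le> energy \<Omega> r g"
proof -
  from exists_energy_minimizer[OF fin g0 gnz, of r] obtain f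
    where f0: "(\<Sum>x\<in>\<Omega>. f x) = 0" and f1: "(\<Sum>x\<in>\<Omega>. (f x)\<^sup>2) = 1"
      and fmin: "\<And>h. (\<Sum>x\<in>\<Omega>. h x) = 0 \<Longrightarrow> energy \<Omega> r f * (\<Sum>x\<in>\<Omega>. (h x)\<^sup>2) \<le> energy \<Omega> r h"
    by blast
  define l where "l = energy \<Omega> r f"
  have kl: "k \<le> l" using poincare[OF f0] f1 by (simp add: l_def)
  \<comment> \<open>The residual of the eigenvalue equation also serves as the direction of
    variation: stationarity along \<open>w\<close> forces its sum of squares to vanish.\<close>
  define w where "w x = - generator \<Omega> r f x - l * f x" for x
  have w0: "(\<Sum>x\<in>\<Omega>. w x) = 0"
    using sum_generator_eq_0[of r \<Omega> f, OF sym] f0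
    by (simp add: w_def sum_subtractf sum_negf sum_distrib_left[symmetric])
  \<comment> \<open>Along the mean-zero functions \<open>f + t * w\<close>, the energy minus
    \<open>l\<close> times the sum of squares is nonnegative and equals 0 at \<open>t = 0\<close>,
    so its coefficient linear in \<open>t\<close> is 0.\<close>
  have "(\<Sum>x\<in>\<Omega>. w x * (- generator \<Omega> r f x)) - l * (\<Sum>x\<in>\<Omega>. f x * w x) = 0"
  proof (rule linear_coeff_eq_0_of_quadratic_nonneg)
    fix t
    have "(\<Sum>x\<in>\<Omega>. f x + t * w x) = 0"
      using f0 w0 by (simp add: sum.distrib sum_distrib_left[symmetric])
    from fmin[OF this] have "l * (\<Sum>x\<in>\<Omega>. (f x + t * w x)\<^sup>2) \<le> energy \<Omega> r (\<lambda>x. f x + t * w x)"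
      by (simp add: l_def)
    moreover have "(\<Sum>x\<in>\<Omega>. (f x + t * w x)\<^sup>2) =
      1 + 2 * t * (\<Sum>x\<in>\<Omega>. f x * w x) + t\<^sup>2 * (\<Sum>x\<in>\<Omega>. (w x)\<^sup>2)"
      unfolding f1[symmetric] sum_distrib_left sum.distrib[symmetric]
      by (rule sum.cong) (auto simp: power2_eq_square algebra_simps)
    ultimately show "0 \<le> 2 * t * ((\<Sum>x\<in>\<Omega>. w x * (- generator \<Omega> r f x)) - l * (\<Sum>x\<in>\<Omega>. f x * w x))
        + t\<^sup>2 * (energy \<Omega> r w - l * (\<Sum>x\<in>\<Omega>. (w x)\<^sup>2))"
      unfolding energy_add_scaled[OF sym] by (simp add: l_def[symmetric] algebra_simps)
  qed
  also have "(\<Sum>x\<in>\<Omega>. w x * (- generator \<Omega> r f x)) - l * (\<Sum>x\<in>\<Omega>. f x * w x) = (\<Sum>x\<in>\<Omega>. (w x)\<^sup>2)"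
    unfolding sum_distrib_left sum_subtractf[symmetric]
    by (rule sum.cong) (auto simp: w_def power2_eq_square algebra_simps)
  finally have "\<forall>x\<in>\<Omega>. w x = 0" using fin by (simp add: sum_nonneg_eq_0_iff)
  moreover have "\<exists>x\<in>\<Omega>. f x \<noteq> 0"
  proof (rule ccontr)
    assume "\<not> ?thesis"
    hence "(\<Sum>x\<in>\<Omega>. (f x)\<^sup>2) = 0" by simp
    thus False using f1 by simp
  qed
  ultimately have ev: "neg_generator_eigenvalue \<Omega> r l"
    unfolding neg_generator_eigenvalue_def w_def by (intro exI[of _ f]) auto
  \<comment> \<open>An eigenfunction for \<open>m \<noteq> 0\<close> has mean zero because the
    generator sums to zero; it therefore competes in the minimization, with Rayleigh quotient
    \<open>m\<close>.\<close>
  have least: "l \<le> m" if "neg_generator_eigenvalue \<Omega> r m \<and> m \<noteq> 0" for m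
  proof -
    from that obtain h where hnz: "\<exists>x\<in>\<Omega>. h x \<noteq> 0"
      and h: "\<And>x. x \<in> \<Omega> \<Longrightarrow> - generator \<Omega> r h x = m * h x"
      unfolding neg_generator_eigenvalue_def by blast
    have "m * (\<Sum>x\<in>\<Omega>. h x) = (\<Sum>x\<in>\<Omega>. - generator \<Omega> r h x)"
      unfolding sum_distrib_left by (rule sum.cong) (auto simp: h)
    also have "\<dots> = 0" using sum_generator_eq_0[of r \<Omega> h, OF sym] by (simp add: sum_negf)
    finally have h0: "(\<Sum>x\<in>\<Omega>. h x) = 0" using that by simp
    have "l * (\<Sum>x\<in>\<Omega>. (h x)\<^sup>2) \<le> energy \<Omega> r h" using fmin[OF h0] by (simp add: l_def)
    also have "\<dots> = (\<Sum>x\<in>\<Omega>. h x * (- generator \<Omega> r h x))"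
      by (rule sum_mult_generator_self[of r h \<Omega>, OF sym, symmetric])
    also have "\<dots> = m * (\<Sum>x\<in>\<Omega>. (h x)\<^sup>2)"
      unfolding sum_distrib_left by (rule sum.cong) (auto simp: h power2_eq_square)
    finally have "l * (\<Sum>x\<in>\<Omega>. (h x)\<^sup>2) \<le> m * (\<Sum>x\<in>\<Omega>. (h x)\<^sup>2)" .
    moreover have "(\<Sum>x\<in>\<Omega>. (h x)\<^sup>2) > 0"
      using hnz fin by (auto intro: sum_pos2)
    ultimately show ?thesis by simp
  qed
  have "spectral_gap \<Omega> r = l"
    unfolding spectral_gap_def using ev kl k least by (intro Least_equality) auto
  thus "k \<le> spectral_gap \<Omega> r" "spectral_gap \<Omega> r * (\<Sum>x\<in>\<Omega>. (g x)\<^sup>2) \<le> energy \<Omega> r g"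
    using kl fmin[OF g0] by (auto simp: l_def)
qed

subsection \<open>Tails of the transition rate\<close>

definition tail_mass :: "(int \<Rightarrow> real) \<Rightarrow> real \<Rightarrow> real" where
  "tail_mass p x = (\<Sum>\<^sub>\<infinity>y\<in>{y::int. x \<le> of_int y}. p y)"

lemma finite_int_between: "finite {z::int. a \<le> of_int z \<and> of_int z < b}"
  for a b :: real
  by (rule finite_subset[of _ "{\<lfloor>a\<rfloor>..\<lceil>b\<rceil>}"]) (auto simp: floor_le_iff le_ceiling_iff)

lemma tail_mass_diff:
  assumes "p summable_on UNIV" and "a \<le> b"
  shows "tail_mass p a - tail_mass p b = sum p {z. a \<le> of_int z \<and> of_int z < b}"
proof -
  have summ: "p summable_on X" for X
    using assms(1) by (rule summable_on_subset_banach) auto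
  have "{y. a \<le> of_int y} = {z. a \<le> of_int z \<and> of_int z < b} \<union> {y::int. b \<le> of_int y}"
    using assms(2) by auto
  hence "tail_mass p a = infsum p {z. a \<le> of_int z \<and> of_int z < b} + tail_mass p b"
    unfolding tail_mass_def by (simp only:) (intro infsum_Un_disjoint summ, auto)
  thus ?thesis using finite_int_between[of a b] by simp
qed

lemma sum_le_tail_mass:
  assumes summ: "p summable_on UNIV" and "\<And>z. 0 \<le> p z" and "finite A" and "\<And>z. z \<in> A \<Longrightarrow> x \<le> of_int z"
  shows "sum p A \<le> tail_mass p x"
  unfolding tail_mass_def
  by (rule finite_sum_le_infsum) (use assms summable_on_subset_banach[OF summ] in auto)

text \<open>Beyond some \<open>X\<close> the limit gives the constant \<open>c + 1\<close>; for
  \<open>1 \<le> x < X\<close> the tail is at most the total mass and \<open>x powr \<alpha>\<close>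
  is bounded.\<close>

lemma tail_mass_upper_bound:
  assumes lim: "((\<lambda>x. x powr \<alpha> * tail_mass p x) \<longlongrightarrow> c) at_top"
    and summ: "p summable_on UNIV" and nonneg: "\<And>z. 0 \<le> p z" and \<alpha>: "0 \<le> \<alpha>"
  shows "\<exists>A>0. \<forall>x\<ge>1. tail_mass p x \<le> A * x powr - \<alpha>"
proof -
  have "\<forall>\<^sub>F x in at_top. x powr \<alpha> * tail_mass p x < c + 1"
    using lim by (rule order_tendstoD) simp
  then obtain X where X: "\<And>x. x \<ge> X \<Longrightarrow> x powr \<alpha> * tail_mass p x < c + 1"
    unfolding eventually_at_top_linorder by blast
  define M where "M = infsum p UNIV"
  have M: "M \<ge> 0" unfolding M_def using nonneg by (intro infsum_nonneg) auto
  have TM: "tail_mass p x \<le> M" for x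
    unfolding tail_mass_def M_def
    by (rule infsum_mono2) (use assms summable_on_subset_banach[OF summ] in auto)
  define Y where "Y = max X 1"
  define A where "A = max 1 (max (c + 1) (Y powr \<alpha> * M))"
  show ?thesis
  proof (intro exI[of _ A] conjI allI impI)
    show "A > 0" by (simp add: A_def)
    fix x :: real assume x: "x \<ge> 1"
    have "x powr \<alpha> * tail_mass p x \<le> A"
    proof (cases "x \<ge> X")
      case True
      thus ?thesis using X[OF True] by (auto simp: A_def)
    next
      case False
      have "x powr \<alpha> * tail_mass p x \<le> Y powr \<alpha> * M"
        using x False \<alpha> M TM
        by (intro mult_mono powr_mono2) (auto simp: Y_def tail_mass_def intro!: infsum_nonneg nonneg)
      thus ?thesis by (auto simp: A_def)
    qed
    thus "tail_mass p x \<le> A * x powr - \<alpha>"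
      using x by (simp add: powr_minus field_simps)
  qed
qed

text \<open>The window mass is a difference of two tails, which after multiplication by
  \<open>x powr \<alpha>\<close> tends to \<open>((1 - \<epsilon>) powr - \<alpha> - 1) * c\<close>.
  This limit is positive, and \<open>m\<close> is taken to be half of it.\<close>

lemma window_mass_lower_bound:
  assumes lim: "((\<lambda>x. x powr \<alpha> * tail_mass p x) \<longlongrightarrow> c) at_top"
    and c: "0 < c" and summ: "p summable_on UNIV" and \<alpha>: "0 < \<alpha>"
    and \<epsilon>: "0 < \<epsilon>" "\<epsilon> < 1"
  shows "\<exists>m>0. \<exists>X\<ge>1. \<forall>x\<ge>X. m * x powr - \<alpha> \<le> sum p {z. (1 - \<epsilon>) * x \<le> of_int z \<and> of_int z < x}"
proof -
  \<comment> \<open>This factor converts \<open>((1 - \<epsilon>) * x) powr \<alpha>\<close> back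
    into \<open>x powr \<alpha>\<close>, so that both tails carry the same weight.\<close>
  define q where "q = (1 - \<epsilon>) powr - \<alpha>"
  have "(1 - \<epsilon>) powr \<alpha> < 1"
    using powr_less_mono2[OF \<alpha>, of "1 - \<epsilon>" 1] \<epsilon> by simp
  hence q: "q > 1" unfolding q_def powr_minus using \<epsilon> by (simp add: one_less_inverse)
  have "filterlim (\<lambda>x. (1 - \<epsilon>) * x) at_top at_top"
    using \<epsilon> by (intro filterlim_tendsto_pos_mult_at_top[OF tendsto_const _ filterlim_ident]) auto
  from filterlim_compose[OF lim this]
  have "((\<lambda>x. q * (((1 - \<epsilon>) * x) powr \<alpha> * tail_mass p ((1 - \<epsilon>) * x)) - x powr \<alpha> * tail_mass p x)
    \<longlongrightarrow> q * c - c) at_top"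
    using lim by (intro tendsto_intros)
  moreover have "q * c - c > (q * c - c) / 2" using q c by simp
  ultimately have "\<forall>\<^sub>F x in at_top. (q * c - c) / 2 <
      q * (((1 - \<epsilon>) * x) powr \<alpha> * tail_mass p ((1 - \<epsilon>) * x)) - x powr \<alpha> * tail_mass p x"
    by (rule order_tendstoD(1))
  then obtain X where X: "\<And>x. x \<ge> X \<Longrightarrow> (q * c - c) / 2 <
      q * (((1 - \<epsilon>) * x) powr \<alpha> * tail_mass p ((1 - \<epsilon>) * x)) - x powr \<alpha> * tail_mass p x"
    unfolding eventually_at_top_linorder by blast
  show ?thesis
  proof (rule exI[of _ "(q * c - c) / 2"], rule conjI, goal_cases)
    case 2
    show ?case
    proof (rule exI[of _ "max X 1"], intro conjI allI impI)
      fix x assume x: "max X 1 \<le> x"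
      have "q * (1 - \<epsilon>) powr \<alpha> = 1" using \<epsilon> by (simp add: q_def powr_minus)
      hence "q * ((1 - \<epsilon>) * x) powr \<alpha> = x powr \<alpha>"
        using x \<epsilon> by (simp add: powr_mult)
      with X[of x] x have "(q * c - c) / 2 < x powr \<alpha> * (tail_mass p ((1 - \<epsilon>) * x) - tail_mass p x)"
        by (simp add: mult.assoc[symmetric] right_diff_distrib)
      also have "tail_mass p ((1 - \<epsilon>) * x) - tail_mass p x = sum p {z. (1 - \<epsilon>) * x \<le> of_int z \<and> of_int z < x}"
        using x \<epsilon> by (intro tail_mass_diff summ) (simp add: mult_left_le_one_le)
      finally show "(q * c - c) / 2 * x powr - \<alpha> \<le> sum p {z. (1 - \<epsilon>) * x \<le> of_int z \<and> of_int z < x}"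
        using x by (simp add: powr_minus field_simps)
    qed simp
  qed (use q c in simp)
qed

section \<open>Power sums and the truncated second moment\<close>

text \<open>For \<open>\<beta> \<ge> 1\<close> a factor \<open>x - 1\<close> is split off and the
  rest is monotone; for \<open>\<beta> < 1\<close> the mean value theorem applies, as
  \<open>z powr (\<beta> - 1)\<close> decreases in \<open>z\<close>. The constant
  \<open>min \<beta> 1\<close> covers both cases.\<close>

lemma powr_diff_ge:
  fixes \<beta> x :: real
  assumes \<beta>: "0 < \<beta>" and x: "1 \<le> x"
  shows "min \<beta> 1 * x powr (\<beta> - 1) \<le> x powr \<beta> - (x - 1) powr \<beta>"
proof (cases "\<beta> \<ge> 1")
  case True
  have "(x - 1) powr \<beta> \<le> (x - 1) * x powr (\<beta> - 1)"
  proof (cases "x = 1")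
    case False
    hence "(x - 1) powr \<beta> = (x - 1) * (x - 1) powr (\<beta> - 1)" using x by (simp add: powr_mult_base)
    also have "\<dots> \<le> (x - 1) * x powr (\<beta> - 1)"
      using x True by (intro mult_left_mono powr_mono2) auto
    finally show ?thesis .
  qed (use \<beta> in auto)
  moreover have "x powr \<beta> = x * x powr (\<beta> - 1)" using x by (simp add: powr_mult_base)
  ultimately show ?thesis using True x by (simp add: left_diff_distrib min_absorb2)
next
  case False
  show ?thesis
  proof (cases "x = 1")
    case True thus ?thesis using \<beta> by auto
  next
    case False': False
    have "\<exists>z. x - 1 < z \<and> z < x \<and> x powr \<beta> - (x - 1) powr \<beta> = (x - (x - 1)) * (\<beta> * z powr (\<beta> - 1))"
      using x False' by (intro MVT2) (auto intro!: derivative_eq_intros simp: powr_diff)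
    then obtain z where z: "x - 1 < z" "z < x" "x powr \<beta> - (x - 1) powr \<beta> = \<beta> * z powr (\<beta> - 1)" by auto
    have "x powr (\<beta> - 1) \<le> z powr (\<beta> - 1)" using z x False' False by (intro powr_mono2') auto
    thus ?thesis using z(3) False \<beta> by (simp add: min_def)
  qed
qed

lemma sum_powr_le:
  assumes "0 < \<beta>"
  shows "min \<beta> 1 * (\<Sum>k=1..M. real k powr (\<beta> - 1)) \<le> real M powr \<beta>"
proof (induction M)
  case (Suc M)
  have "min \<beta> 1 * real (Suc M) powr (\<beta> - 1) \<le> real (Suc M) powr \<beta> - real M powr \<beta>"
    using powr_diff_ge[OF assms, of "real (Suc M)"] by simp
  thus ?case using Suc.IH by (simp add: distrib_left)
qed simp

text \<open>Summation by parts: bounding \<open>d\<^sup>2\<close> by a sum over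
  \<open>k \<le> d\<close> and exchanging the sums leaves masses of \<open>{k..M}\<close>,
  controlled by the tail bound. What remains is a power sum with exponent
  \<open>1 - \<alpha> > -1\<close>.\<close>

lemma truncated_second_moment_bound:
  assumes "\<alpha> < 2" and "A > 0" and summ: "p summable_on UNIV" and nonneg: "\<And>z. 0 \<le> p z"
    and tail: "\<And>x. x \<ge> 1 \<Longrightarrow> tail_mass p x \<le> A * x powr - \<alpha>"
  shows "\<exists>B>0. \<forall>M::nat. (\<Sum>d=1..M. p (int d) * (real d)\<^sup>2) \<le> B * real M powr (2 - \<alpha>)"
proof -
  define \<beta> where "\<beta> = 2 - \<alpha>"
  have \<beta>: "\<beta> > 0" using assms by (simp add: \<beta>_def)
  have tri: "(real d)\<^sup>2 \<le> (\<Sum>k=1..d. 2 * real k)" for d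
    by (induction d) (auto simp: power2_eq_square algebra_simps)
  have "(\<Sum>d=1..M. p (int d) * (real d)\<^sup>2) \<le> (2 * A / min \<beta> 1) * real M powr \<beta>" for M
  proof -
    have "(\<Sum>d=1..M. p (int d) * (real d)\<^sup>2) \<le> (\<Sum>d=1..M. p (int d) * (\<Sum>k=1..d. 2 * real k))"
      by (intro sum_mono mult_left_mono tri nonneg)
    also have "\<dots> = (\<Sum>d=1..M. \<Sum>k | k \<in> {1..M} \<and> k \<le> d. p (int d) * (2 * real k))"
      unfolding sum_distrib_left by (intro sum.cong) auto
    also have "\<dots> = (\<Sum>k=1..M. \<Sum>d | d \<in> {1..M} \<and> k \<le> d. p (int d) * (2 * real k))"
      by (rule sum.swap_restrict) auto
    also have "\<dots> = (\<Sum>k=1..M. 2 * real k * sum p (int ` {d. d \<in> {1..M} \<and> k \<le> d}))"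
      by (subst sum.reindex) (auto simp: sum_distrib_left mult_ac)
    also have "\<dots> \<le> (\<Sum>k=1..M. 2 * real k * (A * real k powr - \<alpha>))"
    proof (intro sum_mono mult_left_mono)
      fix k assume k: "k \<in> {1..M}"
      have "sum p (int ` {d. d \<in> {1..M} \<and> k \<le> d}) \<le> tail_mass p (real k)"
        by (intro sum_le_tail_mass summ nonneg) auto
      also have "\<dots> \<le> A * real k powr - \<alpha>" using k by (intro tail) auto
      finally show "sum p (int ` {d. d \<in> {1..M} \<and> k \<le> d}) \<le> A * real k powr - \<alpha>" .
    qed auto
    also have "\<dots> = 2 * A * (\<Sum>k=1..M. real k powr (\<beta> - 1))"
      unfolding sum_distrib_left
      by (intro sum.cong) (auto simp: \<beta>_def powr_diff powr_minus field_simps)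
    also have "\<dots> \<le> 2 * A * (real M powr \<beta> / min \<beta> 1)"
      using sum_powr_le[OF \<beta>, of M] \<beta> \<open>A > 0\<close> by (intro mult_left_mono) (auto simp: field_simps)
    finally show ?thesis by simp
  qed
  thus ?thesis using \<beta> \<open>A > 0\<close> unfolding \<beta>_def[symmetric]
    by (intro exI[of _ "2 * A / min \<beta> 1"]) auto
qed

subsection \<open>Shift energies\<close>

text \<open>Used for \<open>d \<ge> 0\<close>, where the range says that \<open>x\<close> and
  \<open>x + d\<close> both lie in \<open>{- int n..int n}\<close>.\<close>

definition shift_energy :: "nat \<Rightarrow> (int \<Rightarrow> real) \<Rightarrow> int \<Rightarrow> real" where
  "shift_energy n f d = (\<Sum>x\<in>{- int n..int n - d}. (f (x + d) - f x)\<^sup>2)"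

lemma shift_energy_nonneg: "0 \<le> shift_energy n f d"
  unfolding shift_energy_def by (intro sum_nonneg) auto

text \<open>A shift by \<open>a + b\<close> passes through \<open>x + a\<close>, which stays in the
  interval because \<open>a\<close> and \<open>b\<close> are nonnegative; then
  \<open>(u + v)\<^sup>2 \<le> 2 * u\<^sup>2 + 2 * v\<^sup>2\<close>.\<close>

lemma shift_energy_add:
  assumes "0 \<le> a" "0 \<le> b"
  shows "shift_energy n f (a + b) \<le> 2 * shift_energy n f a + 2 * shift_energy n f b"
proof -
  let ?I = "{- int n..int n - (a + b)}"
  have "shift_energy n f (a + b) \<le> (\<Sum>x\<in>?I. 2 * (f (x + a) - f x)\<^sup>2 + 2 * (f (x + a + b) - f (x + a))\<^sup>2)"
    unfolding shift_energy_def
  proof (rule sum_mono)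
    fix x
    show "(f (x + (a + b)) - f x)\<^sup>2 \<le> 2 * (f (x + a) - f x)\<^sup>2 + 2 * (f (x + a + b) - f (x + a))\<^sup>2"
      using sum_squares_bound[of "f (x + a) - f x" "f (x + a + b) - f (x + a)"]
      by (simp add: power2_eq_square algebra_simps)
  qed
  also have "\<dots> = 2 * (\<Sum>x\<in>?I. (f (x + a) - f x)\<^sup>2) + 2 * (\<Sum>x\<in>?I. (f (x + a + b) - f (x + a))\<^sup>2)"
    by (simp add: sum.distrib sum_distrib_left)
  also have "(\<Sum>x\<in>?I. (f (x + a) - f x)\<^sup>2) \<le> shift_energy n f a"
    unfolding shift_energy_def using assms by (intro sum_mono2) auto
  also have "(\<Sum>x\<in>?I. (f (x + a + b) - f (x + a))\<^sup>2) = (\<Sum>x\<in>(\<lambda>x. x + a) ` ?I. (f (x + b) - f x)\<^sup>2)"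
    by (subst sum.reindex) auto
  also have "\<dots> \<le> shift_energy n f b"
    unfolding shift_energy_def using assms by (intro sum_mono2) auto
  finally show ?thesis by simp
qed

text \<open>Cauchy-Schwarz along a path of \<open>d\<close> unit steps costs one factor
  \<open>d\<close>; the other comes from adding \<open>d\<close> translated copies, each at most
  \<open>shift_energy n f 1\<close>.\<close>

lemma shift_energy_le_square: "shift_energy n f (int d) \<le> (real d)\<^sup>2 * shift_energy n f 1"
proof -
  have "shift_energy n f (int d) \<le> (\<Sum>x\<in>{- int n..int n - int d}. real d * (\<Sum>i<d. (f (x + int i + 1) - f (x + int i))\<^sup>2))"
    unfolding shift_energy_def
  proof (rule sum_mono)
    fix x
    have "f (x + int d) - f x = (\<Sum>i<d. f (x + int (Suc i)) - f (x + int i))"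
      by (subst sum_lessThan_telescope) simp
    also have "\<dots> = (\<Sum>i<d. 1 * (f (x + int i + 1) - f (x + int i)))"
      by (simp add: add_ac)
    also have "(\<dots>)\<^sup>2 \<le> (\<Sum>i<d. 1\<^sup>2) * (\<Sum>i<d. (f (x + int i + 1) - f (x + int i))\<^sup>2)"
      by (rule Cauchy_Schwarz_ineq_sum)
    finally show "(f (x + int d) - f x)\<^sup>2 \<le> real d * (\<Sum>i<d. (f (x + int i + 1) - f (x + int i))\<^sup>2)"
      by simp
  qed
  also have "\<dots> = real d * (\<Sum>i<d. \<Sum>x\<in>{- int n..int n - int d}. (f (x + int i + 1) - f (x + int i))\<^sup>2)"
    by (subst sum.swap) (simp add: sum_distrib_left)
  also have "\<dots> \<le> real d * (\<Sum>i<d. shift_energy n f 1)"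
  proof (intro mult_left_mono sum_mono)
    fix i assume i: "i \<in> {..<d}"
    have "(\<Sum>x\<in>{- int n..int n - int d}. (f (x + int i + 1) - f (x + int i))\<^sup>2)
        = (\<Sum>x\<in>(\<lambda>x. x + int i) ` {- int n..int n - int d}. (f (x + 1) - f x)\<^sup>2)"
      by (subst sum.reindex) auto
    also have "\<dots> \<le> shift_energy n f 1"
      unfolding shift_energy_def using i by (intro sum_mono2) auto
    finally show "(\<Sum>x\<in>{- int n..int n - int d}. (f (x + int i + 1) - f (x + int i))\<^sup>2) \<le> shift_energy n f 1" .
  qed auto
  finally show ?thesis by (simp add: power2_eq_square)
qed

section \<open>Energy and variance as sums over distances\<close>

text \<open>The diagonal drops out and the two orders of a pair contribute equally; pairs with
  \<open>x < y\<close> are listed by distance and left endpoint.\<close>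

lemma sum_pairs_by_distance:
  fixes F :: "int \<Rightarrow> int \<Rightarrow> real"
  assumes sym: "\<And>x y. F x y = F y x" and diag: "\<And>x. F x x = 0"
  shows "(\<Sum>x\<in>{- int n..int n}. \<Sum>y\<in>{- int n..int n}. F x y) =
    2 * (\<Sum>d=1..2*n. \<Sum>x\<in>{- int n..int n - int d}. F x (x + int d))"
proof -
  let ?A = "{- int n..int n}"
  have fin: "finite {y. - int n \<le> y \<and> y \<le> int n \<and> x < y}" for x
    by (rule finite_subset[of _ ?A]) auto
  have lt: "(\<Sum>x\<in>?A. \<Sum>y\<in>{y\<in>?A. x < y}. F x y) =
      (\<Sum>d=1..2*n. \<Sum>x\<in>{- int n..int n - int d}. F x (x + int d))"
    using fin by (subst (1 2) sum.Sigma)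
       (auto intro!: sum.reindex_bij_witness[where i="\<lambda>(d, x). (x, x + int d)" and
          j="\<lambda>(x, y). (nat (y - x), x)"])
  have gt: "(\<Sum>x\<in>?A. \<Sum>y\<in>{y\<in>?A. y < x}. F x y) = (\<Sum>x\<in>?A. \<Sum>y\<in>{y\<in>?A. x < y}. F x y)"
  proof -
    have "(\<Sum>x\<in>?A. \<Sum>y\<in>{y\<in>?A. y < x}. F x y) = (\<Sum>y\<in>?A. \<Sum>x\<in>{x\<in>?A. y < x}. F x y)"
      by (rule sum.swap_restrict) auto
    thus ?thesis by (simp add: sym)
  qed
  have "(\<Sum>y\<in>?A. F x y) = (\<Sum>y\<in>{y\<in>?A. x < y}. F x y) + (\<Sum>y\<in>{y\<in>?A. y < x}. F x y)" for x
  proof -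
    have "(\<Sum>y\<in>?A. F x y) = (\<Sum>y\<in>{y\<in>?A. x < y} \<union> {y\<in>?A. y < x}. F x y)"
      by (rule sum.mono_neutral_right) (auto simp: diag not_less order_le_less)
    also have "\<dots> = (\<Sum>y\<in>{y\<in>?A. x < y}. F x y) + (\<Sum>y\<in>{y\<in>?A. y < x}. F x y)"
      by (rule sum.union_disjoint) (auto intro: finite_subset[of _ ?A])
    finally show ?thesis .
  qed
  thus ?thesis using lt gt by (simp add: sum.distrib)
qed

lemma energy_eq_sum_shift_energy:
  assumes "\<And>z. p z = p (- z)"
  shows "energy {- int n..int n} (\<lambda>x y. p (y - x)) f = (\<Sum>d=1..2*n. p (int d) * shift_energy n f (int d))"
proof -
  have sym: "p (x - y) = p (y - x)" for x y using assms[of "x - y"] by simp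
  have "p (int d) * shift_energy n f (int d) =
      (\<Sum>x\<in>{- int n..int n - int d}. p (x + int d - x) * (f x - f (x + int d))\<^sup>2)" for d
    by (simp add: shift_energy_def sum_distrib_left power2_commute)
  thus ?thesis
    unfolding energy_def by (subst sum_pairs_by_distance) (auto simp: sym power2_commute)
qed

text \<open>In the double sum of \<open>(f x - f y)\<^sup>2\<close> the cross term is a multiple of
  the squared sum of \<open>f\<close> and vanishes; \<open>2 * real n + 1\<close> counts the points
  of the interval.\<close>

lemma sum_squares_eq_sum_shift_energy:
  assumes "(\<Sum>x\<in>{- int n..int n}. f x) = 0"
  shows "(2 * real n + 1) * (\<Sum>x\<in>{- int n..int n}. (f x)\<^sup>2) = (\<Sum>d=1..2*n. shift_energy n f (int d))"
proof -
  let ?A = "{- int n..int n}"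
  have "(\<Sum>x\<in>?A. \<Sum>y\<in>?A. (f x - f y)\<^sup>2) =
      (\<Sum>x\<in>?A. \<Sum>y\<in>?A. (f x)\<^sup>2 + (f y)\<^sup>2 - 2 * (f x * f y))"
    by (intro sum.cong refl) (simp add: power2_eq_square algebra_simps)
  also have "\<dots> = 2 * ((2 * real n + 1) * (\<Sum>x\<in>?A. (f x)\<^sup>2)) - 2 * ((\<Sum>x\<in>?A. f x) * (\<Sum>y\<in>?A. f y))"
    by (simp add: sum.distrib sum_subtractf sum_distrib_left[symmetric] sum_distrib_right[symmetric])
  finally have "2 * ((2 * real n + 1) * (\<Sum>x\<in>?A. (f x)\<^sup>2)) = (\<Sum>x\<in>?A. \<Sum>y\<in>?A. (f x - f y)\<^sup>2)"
    using assms by simp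
  also have "\<dots> = 2 * (\<Sum>d=1..2*n. shift_energy n f (int d))"
    by (subst sum_pairs_by_distance) (auto simp: power2_commute shift_energy_def intro!: sum.cong)
  finally show ?thesis by simp
qed

section \<open>Inductive comparison of shift energies with the Dirichlet form\<close>

text \<open>In the constant, \<open>X\<^sup>2 / p 1\<close> pays for \<open>d < X\<close>, where no
  window bound is available, and \<open>4 / m\<close> makes the averaged term at most half of the
  claim. The condition on \<open>\<epsilon>\<close> keeps the term from the induction hypothesis
  within the other half.\<close>

lemma shift_energy_le:
  assumes \<alpha>: "0 < \<alpha>" and nonneg: "\<And>z. 0 \<le> p z" and p1: "p 1 > 0"
    and \<epsilon>: "0 < \<epsilon>" "\<epsilon> < 1" "2 * \<epsilon> powr \<alpha> \<le> 1 / 2" and m: "m > 0" and X: "X \<ge> 1"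
    and window: "\<And>x. x \<ge> X \<Longrightarrow> m * x powr - \<alpha> \<le> sum p {z. (1 - \<epsilon>) * x \<le> of_int z \<and> of_int z < x}"
    and d: "1 \<le> d" "d \<le> 2 * n"
  shows "shift_energy n f (int d) \<le> max (X\<^sup>2 / p 1) (4 / m) * real d powr \<alpha> *
    (\<Sum>d=1..2*n. p (int d) * shift_energy n f (int d))"
  using d
proof (induction d rule: less_induct)
  case (less d)
  define D where "D = (\<Sum>d=1..2*n. p (int d) * shift_energy n f (int d))"
  define C where "C = max (X\<^sup>2 / p 1) (4 / m)"
  have D: "D \<ge> 0" unfolding D_def by (intro sum_nonneg mult_nonneg_nonneg nonneg shift_energy_nonneg)
  have C: "C \<ge> X\<^sup>2 / p 1" "C \<ge> 4 / m" "C > 0" using m by (auto simp: C_def less_max_iff_disj)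
  have dpos: "real d \<ge> 1" using less.prems by simp
  show ?case
    unfolding C_def[symmetric] D_def[symmetric]
  proof (cases "real d \<ge> X")
    case False
    have "p 1 * shift_energy n f 1 \<le> D"
      unfolding D_def using less.prems
      by (intro order.trans[OF _ member_le_sum[of 1]] mult_nonneg_nonneg nonneg shift_energy_nonneg) auto
    hence S1: "shift_energy n f 1 \<le> D / p 1" using p1 by (simp add: field_simps)
    have "shift_energy n f (int d) \<le> (real d)\<^sup>2 * shift_energy n f 1" by (rule shift_energy_le_square)
    also have "\<dots> \<le> X\<^sup>2 * (D / p 1)"
      using False S1 by (intro mult_mono power_mono shift_energy_nonneg) auto
    also have "\<dots> = (X\<^sup>2 / p 1) * 1 * D" by simp
    also have "\<dots> \<le> C * real d powr \<alpha> * D"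
      using C D dpos \<alpha> by (intro mult_right_mono mult_mono ge_one_powr_ge_zero) auto
    finally show "shift_energy n f (int d) \<le> C * real d powr \<alpha> * D" .
  next
    case True
    define W where "W = {z::int. (1 - \<epsilon>) * real d \<le> of_int z \<and> of_int z < real d}"
    \<comment> \<open>Common bound, by the induction hypothesis, for the shift energies at the
      remaining distances \<open>d - z\<close>, which are at least 1, below \<open>d\<close> and at
      most \<open>\<epsilon> * real d\<close>.\<close>
    define Q where "Q = C * (\<epsilon> * real d) powr \<alpha> * D"
    have finW: "finite W" unfolding W_def by (rule finite_int_between)
    have Wpos: "1 \<le> z" "z < int d" if "z \<in> W" for z
    proof -
      have "0 < (1 - \<epsilon>) * real d" using \<epsilon> dpos by simp
      also have "\<dots> \<le> of_int z" using that by (simp add: W_def)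
      finally show "1 \<le> z" by linarith
      show "z < int d" using that by (simp add: W_def)
    qed
    have step: "shift_energy n f (int d) \<le> 2 * shift_energy n f z + 2 * Q" if z: "z \<in> W" for z
    proof -
      define k where "k = nat (int d - z)"
      have k: "int k = int d - z" "1 \<le> k" "k < d" using Wpos[OF z] by (auto simp: k_def)
      have "real k = real d - of_int z" using k(1) by linarith
      hence kle: "real k \<le> \<epsilon> * real d" using z by (simp add: W_def algebra_simps)
      have "shift_energy n f (int k) \<le> C * real k powr \<alpha> * D"
        using less.IH[of k] k less.prems by (simp add: C_def D_def)
      also have "\<dots> \<le> Q"
        unfolding Q_def using kle C D \<alpha> by (intro mult_right_mono mult_left_mono powr_mono2) auto
      finally have "shift_energy n f (int k) \<le> Q" .
      moreover have "shift_energy n f (z + int k) \<le> 2 * shift_energy n f z + 2 * shift_energy n f (int k)"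
        using Wpos[OF z] by (intro shift_energy_add) auto
      ultimately show ?thesis using k(1) by simp
    qed
    have "sum p W * shift_energy n f (int d) = (\<Sum>z\<in>W. p z * shift_energy n f (int d))"
      by (simp add: sum_distrib_right)
    also have "\<dots> \<le> (\<Sum>z\<in>W. p z * (2 * shift_energy n f z + 2 * Q))"
      by (intro sum_mono mult_left_mono step nonneg)
    also have "\<dots> = 2 * (\<Sum>z\<in>W. p z * shift_energy n f z) + sum p W * (2 * Q)"
      by (simp add: sum_distrib_left sum_distrib_right sum.distrib algebra_simps)
    also have "(\<Sum>z\<in>W. p z * shift_energy n f z) \<le> D"
    proof -
      have "(\<Sum>z\<in>W. p z * shift_energy n f z) \<le> (\<Sum>z\<in>int ` {1..2*n}. p z * shift_energy n f z)"
      proof (rule sum_mono2)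
        show "W \<subseteq> int ` {1..2*n}"
        proof
          fix z assume "z \<in> W"
          from Wpos[OF this] less.prems show "z \<in> int ` {1..2*n}"
            by (intro image_eqI[of _ _ "nat z"]) auto
        qed
      qed (auto intro!: mult_nonneg_nonneg nonneg shift_energy_nonneg)
      also have "\<dots> = D" unfolding D_def by (subst sum.reindex) auto
      finally show ?thesis .
    qed
    finally have "sum p W * (shift_energy n f (int d) - 2 * Q) \<le> 2 * D" by (simp add: algebra_simps)
    \<comment> \<open>Replacing \<open>sum p W\<close> by its lower bound requires the other factor
      to be nonnegative; if it is negative, the claim holds because the right-hand side is
      nonnegative.\<close>
    have "shift_energy n f (int d) - 2 * Q \<le> 2 * D / (m * real d powr - \<alpha>)"
    proof (cases "shift_energy n f (int d) - 2 * Q \<ge> 0")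
      case nn: True
      have "m * real d powr - \<alpha> * (shift_energy n f (int d) - 2 * Q) \<le> sum p W * (shift_energy n f (int d) - 2 * Q)"
        unfolding W_def by (intro mult_right_mono window True nn)
      also have "\<dots> \<le> 2 * D" by fact
      finally show ?thesis using m dpos by (simp add: field_simps)
    next
      case False
      moreover have "2 * D / (m * real d powr - \<alpha>) \<ge> 0" using D m by simp
      ultimately show ?thesis by linarith
    qed
    also have "\<dots> = (4 / m) * (real d powr \<alpha> * D / 2)"
      using m dpos by (simp add: powr_minus field_simps)
    also have "\<dots> \<le> C * (real d powr \<alpha> * D / 2)"
      using C D by (intro mult_right_mono) auto
    finally have "shift_energy n f (int d) \<le> 2 * Q + C * (real d powr \<alpha> * D / 2)" by simp
    also have "2 * Q = (2 * \<epsilon> powr \<alpha>) * (C * real d powr \<alpha> * D)"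
      unfolding Q_def using \<epsilon> by (simp add: powr_mult)
    also have "\<dots> \<le> (1 / 2) * (C * real d powr \<alpha> * D)"
      using \<epsilon>(3) C D by (intro mult_right_mono) auto
    finally show "shift_energy n f (int d) \<le> C * real d powr \<alpha> * D" by (simp add: field_simps)
  qed
qed

section \<open>The linear test function and the two bounds\<close>

lemma sum_squares_symmetric_interval:
  "(\<Sum>x\<in>{- int n..int n}. (real_of_int x)\<^sup>2) = real n * (real n + 1) * (2 * real n + 1) / 3"
proof (induction n)
  case (Suc n)
  have "{- int (Suc n)..int (Suc n)} = insert (- int n - 1) (insert (int n + 1) {- int n..int n})" by auto
  thus ?case using Suc by (simp add: power2_eq_square field_simps)
qed simp

lemma sum_symmetric_interval: "(\<Sum>x\<in>{- int n..int n}. real_of_int x) = 0"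
proof (induction n)
  case (Suc n)
  have "{- int (Suc n)..int (Suc n)} = insert (- int n - 1) (insert (int n + 1) {- int n..int n})" by auto
  thus ?case using Suc by simp
qed simp

theorem theorem1p2:
  fixes \<alpha> :: real and p :: "int \<Rightarrow> real"
  assumes "0 < \<alpha>" and "\<alpha> < 2"
    and "transition_rate p" and "symmetric_rate p" and "DAN \<alpha> p"
    and "p 1 > 0"
  shows "\<exists>\<kappa>1 \<kappa>2 :: real. 0 < \<kappa>1 \<and> 0 < \<kappa>2 \<and>
    (\<forall>n::nat. 1 \<le> n \<longrightarrow>
       \<kappa>1 * (2 * real n + 1) powr (- \<alpha>) \<le> spectral_gap {- int n..int n} (\<lambda>x y. p (y - x)) \<and>
       spectral_gap {- int n..int n} (\<lambda>x y. p (y - x)) \<le> \<kappa>2 * (2 * real n + 1) powr (- \<alpha>))"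
proof -
  have nonneg: "\<And>z. 0 \<le> p z" and summ: "p summable_on UNIV"
    using assms(3) by (auto simp: transition_rate_def)
  have psym: "\<And>z. p z = p (- z)" using assms(4) unfolding symmetric_rate_def by blast
  from assms(5) obtain c where c: "c > 0" "((\<lambda>x. x powr \<alpha> * tail_mass p x) \<longlongrightarrow> c) at_top"
    unfolding DAN_def tail_mass_def by blast
  \<comment> \<open>Chosen so that \<open>\<epsilon> powr \<alpha> = 1 / 4\<close>.\<close>
  define \<epsilon> :: real where "\<epsilon> = (1 / 4) powr (1 / \<alpha>)"
  have \<epsilon>: "0 < \<epsilon>" "\<epsilon> < 1" "2 * \<epsilon> powr \<alpha> \<le> 1 / 2"
    using assms(1) powr_less_mono2[of "1 / \<alpha>" "1 / 4" 1] by (auto simp: \<epsilon>_def powr_powr)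
  from window_mass_lower_bound[OF c(2,1) summ assms(1) \<epsilon>(1,2)] obtain m X
    where m: "m > 0" and X: "X \<ge> 1" and window: "\<And>x. x \<ge> X \<Longrightarrow>
      m * x powr - \<alpha> \<le> sum p {z. (1 - \<epsilon>) * x \<le> of_int z \<and> of_int z < x}" by blast
  from tail_mass_upper_bound[OF c(2) summ nonneg] assms(1) obtain A
    where A: "A > 0" "\<And>x. x \<ge> 1 \<Longrightarrow> tail_mass p x \<le> A * x powr - \<alpha>" by auto
  from truncated_second_moment_bound[OF assms(2) A(1) summ nonneg A(2)] obtain B
    where B: "B > 0" "\<And>M. (\<Sum>d=1..M. p (int d) * (real d)\<^sup>2) \<le> B * real M powr (2 - \<alpha>)" by blast
  define C where "C = max (X\<^sup>2 / p 1) (4 / m)"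
  have C: "C > 0" using m by (auto simp: C_def less_max_iff_disj)
  show ?thesis
  proof (rule exI[of _ "1 / C"], rule exI[of _ "18 * B"], intro conjI allI impI)
    show "0 < 1 / C" "0 < 18 * B" using C B by auto
    fix n :: nat assume n: "1 \<le> n"
    let ?\<Omega> = "{- int n..int n}" and ?r = "\<lambda>x y. p (y - x)" and ?N = "2 * real n + 1"
    let ?k = "1 / C * ?N powr - \<alpha>"
    have rsym: "?r x y = ?r y x" for x y using psym[of "x - y"] by simp
    have poincare: "?k * (\<Sum>x\<in>?\<Omega>. (h x)\<^sup>2) \<le> energy ?\<Omega> ?r h" if h0: "(\<Sum>x\<in>?\<Omega>. h x) = 0" for h
    proof -
      let ?D = "energy ?\<Omega> ?r h"
      have Deq: "?D = (\<Sum>d=1..2*n. p (int d) * shift_energy n h (int d))"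
        by (rule energy_eq_sum_shift_energy) (rule psym)
      have D: "?D \<ge> 0" unfolding Deq by (intro sum_nonneg mult_nonneg_nonneg nonneg shift_energy_nonneg)
      have "?N * (\<Sum>x\<in>?\<Omega>. (h x)\<^sup>2) = (\<Sum>d=1..2*n. shift_energy n h (int d))"
        by (rule sum_squares_eq_sum_shift_energy[OF h0])
      also have "\<dots> \<le> (\<Sum>d=1..2*n. C * ?N powr \<alpha> * ?D)"
      proof (rule sum_mono)
        fix d assume d: "d \<in> {1..2*n}"
        have "shift_energy n h (int d) \<le> C * real d powr \<alpha> * ?D"
          unfolding Deq C_def
          by (rule shift_energy_le[OF assms(1) nonneg assms(6) \<epsilon> m X window]) (use d in auto)
        also have "\<dots> \<le> C * ?N powr \<alpha> * ?D"
          using d C D assms(1) by (intro mult_right_mono mult_left_mono powr_mono2) auto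
        finally show "shift_energy n h (int d) \<le> C * ?N powr \<alpha> * ?D" .
      qed
      also have "\<dots> = (2 * real n) * (C * ?N powr \<alpha> * ?D)" by simp
      \<comment> \<open>Enlarging the number \<open>2 * n\<close> of distances to \<open>?N\<close>
        lets the factor \<open>?N\<close> of the variance identity cancel.\<close>
      also have "\<dots> \<le> ?N * (C * ?N powr \<alpha> * ?D)" using C D by (intro mult_right_mono) auto
      finally have "(\<Sum>x\<in>?\<Omega>. (h x)\<^sup>2) \<le> C * ?N powr \<alpha> * ?D"
        by (subst (asm) mult_le_cancel_left_pos) auto
      hence "?k * (\<Sum>x\<in>?\<Omega>. (h x)\<^sup>2) \<le> ?k * (C * ?N powr \<alpha> * ?D)"
        using C by (intro mult_left_mono) auto
      also have "\<dots> = ?D" using C by (simp add: powr_minus)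
      finally show ?thesis .
    qed
    let ?g = "\<lambda>x::int. real_of_int x"
    have V: "(\<Sum>x\<in>?\<Omega>. (?g x)\<^sup>2) \<ge> ?N ^ 3 / 18"
    proof -
      \<comment> \<open>Here \<open>n \<ge> 1\<close> enters: the bound on \<open>?N\<^sup>2\<close>
        amounts to \<open>1 \<le> 2 * n * (n + 1)\<close>. For \<open>n = 0\<close> the single state
        has no non-zero eigenvalue.\<close>
      have "1 * 1 \<le> real n * (real n + 1)" using n by (intro mult_mono) auto
      hence N2: "?N\<^sup>2 \<le> 6 * (real n * (real n + 1))" by (simp add: power2_eq_square algebra_simps)
      have "?N ^ 3 / 18 = ?N\<^sup>2 * ?N / 18" by (simp add: power2_eq_square power3_eq_cube)
      also have "\<dots> \<le> 6 * (real n * (real n + 1)) * ?N / 18"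
        by (intro divide_right_mono mult_right_mono N2) auto
      also have "\<dots> = real n * (real n + 1) * ?N / 3" by simp
      finally show ?thesis unfolding sum_squares_symmetric_interval .
    qed
    have k: "?k > 0" using C by simp
    have Vpos: "(\<Sum>x\<in>?\<Omega>. (?g x)\<^sup>2) > 0" by (rule less_le_trans[OF _ V]) simp
    note gap = spectral_gap_variational[where r="?r" and k="?k" and g="?g",
        OF finite_atLeastAtMost_int rsym k poincare sum_symmetric_interval Vpos]
    show "?k \<le> spectral_gap ?\<Omega> ?r" by (rule gap(1))
    \<comment> \<open>The lower bound already shows that the gap is nonnegative, so the sum of
      squares may be replaced by a smaller quantity.\<close>
    have "spectral_gap ?\<Omega> ?r * (?N ^ 3 / 18) \<le> spectral_gap ?\<Omega> ?r * (\<Sum>x\<in>?\<Omega>. (?g x)\<^sup>2)"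
      using gap(1) k V by (intro mult_left_mono) auto
    also have "\<dots> \<le> energy ?\<Omega> ?r ?g" by (rule gap(2))
    also have "\<dots> = (\<Sum>d=1..2*n. p (int d) * shift_energy n ?g (int d))"
      by (rule energy_eq_sum_shift_energy) (rule psym)
    \<comment> \<open>The identity function has increment \<open>d\<close> over distance
      \<open>d\<close>, and there are at most \<open>?N\<close> starting points.\<close>
    also have "\<dots> \<le> (\<Sum>d=1..2*n. ?N * (p (int d) * (real d)\<^sup>2))"
    proof (rule sum_mono)
      fix d assume "d \<in> {1..2*n}"
      hence "shift_energy n ?g (int d) \<le> ?N * (real d)\<^sup>2"
        unfolding shift_energy_def by (auto intro!: mult_right_mono)
      from mult_left_mono[OF this nonneg]
      show "p (int d) * shift_energy n ?g (int d) \<le> ?N * (p (int d) * (real d)\<^sup>2)" by (simp add: mult_ac)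
    qed
    also have "\<dots> \<le> ?N * (B * ?N powr (2 - \<alpha>))"
      unfolding sum_distrib_left[symmetric]
    proof (rule mult_left_mono)
      have "(\<Sum>d=1..2*n. p (int d) * (real d)\<^sup>2) \<le> B * real (2 * n) powr (2 - \<alpha>)" by (rule B(2))
      also have "\<dots> \<le> B * ?N powr (2 - \<alpha>)"
        using B(1) assms(2) by (intro mult_left_mono powr_mono2) auto
      finally show "(\<Sum>d=1..2*n. p (int d) * (real d)\<^sup>2) \<le> B * ?N powr (2 - \<alpha>)" .
    qed simp
    also have "\<dots> = 18 * B * ?N powr - \<alpha> * (?N ^ 3 / 18)"
      by (simp add: powr_diff powr_minus power3_eq_cube power2_eq_square field_simps)
    finally show "spectral_gap ?\<Omega> ?r \<le> 18 * B * ?N powr - \<alpha>"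
      by (subst (asm) mult_le_cancel_right_pos) auto
  qed
qed

end
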